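(* Let $\Omega,\mathcal H,\Gamma,t,T,L,C_i,C_j,\varepsilon_i,\varepsilon_j,\tau_i,\tau_j,B_i,B_j,P_i,P_j$ satisfy all the conditions of the common bi-Lipschitz random map setting described in the context. Let $W_{2,d_\Omega}(C_i,C_j)$ be the quadratic Wasserstein distance between $C_i$ and $C_j$ with ground metric $d_\Omega$, and with $(x)_+:=\max\{x,0\}$ put $$w^-_{ij}:=\bigl(L^{-1}W_{2,d_\Omega}(C_i,C_j)-\tau_i-\tau_j\bigr)_+,\qquad w^+_{ij}:=L\,W_{2,d_\Omega}(C_i,C_j)+\tau_i+\tau_j.$$ Let $v_k=\mathbb E\|\Gamma^{1/2}B_k\|^2$ for $k\in\{i,j\}$, let $$W_{2,\Gamma}^2(P_i,P_j)=\inf_\pi\int\|\Gamma^{1/2}b-\Gamma^{1/2}b'\|_{\mathcal H}^2\,d\pi(b,b')$$ with the infimum over all couplings $\pi$ of $P_i$ and $P_j$, and let $\bar\kappa_{ij}=\tfrac12\bigl(v_i+v_j-W_{2,\Gamma}^2(P_i,P_j)\bigr)$. Then $$\tfrac12\bigl(v_i+v_j-(w^+_{ij})^2\bigr)\;\le\;\bar\kappa_{ij}\;\le\;\tfrac12\bigl(v_i+v_j-(w^-_{ij})^2\bigr).$$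
   Context: Common bi-Lipschitz random map setting. $(\Omega,d_\Omega)$ is a Polish metric space with its Borel $\sigma$-algebra; $\mathcal P_2(\Omega)$ is the set of Borel probability measures $C$ on $\Omega$ with $\int_\Omega d_\Omega(\omega,\omega_0)^2\,C(d\omega)<\infty$ for some (equivalently any) $\omega_0\in\Omega$. $\mathcal H$ is a real separable Hilbert space; $\Gamma:\mathcal H\to\mathcal H$ is a bounded, positive, self-adjoint operator and $\Gamma^{1/2}$ is its unique bounded positive square root. The common carrier $t:\Omega\to\mathcal H$ is Borel measurable, and $t_\Gamma:=\Gamma^{1/2}\circ t$ is a Borel embedding with a Borel inverse on its image. For some $L\ge 1$ and all $x,y\in\Omega$, $$L^{-1}d_\Omega(x,y)\le\|t_\Gamma(x)-t_\Gamma(y)\|_{\mathcal H}\le L\,d_\Omega(x,y).$$ $\mathcal U$ is a measurable space and $T:\Omega\times\mathcal U\to\mathcal H$ is (Borel) measurable. $C_i,C_j\in\mathcal P_2(\Omega)$ are the characteristic laws of two firms $i,j$. For $k\in\{i,j\}$, $X_k\sim C_k$, $U_k$ is a $\mathcal U$-valued transmission draw with a law common to both firms, and the exposure random element is $$B_k=T(X_k,U_k)=t(X_k)+\varepsilon_k(X_k,U_k),$$ where $\varepsilon_k:\Omega\times\mathcal U\to\mathcal H$ is Borel measurable with $\|\Gamma^{1/2}\varepsilon_k(x,u)\|_{\mathcal H}\le\tau_k$ for all $(x,u)$, for a constant $\tau_k\ge0$. The exposure law is $P_k:=\mathcal L(B_k)$; equivalently $P_k=C_kK$ for the stochastic kernel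 $K(x,\cdot)=\mathcal L(T(x,U))$ with $U$ a transmission draw. It is assumed that $P_i,P_j\in\mathcal P_2(\mathcal H)$, i.e. $P_i$ and $P_j$ have finite second moment (hence also finite $\Gamma$-weighted second moment). The quadratic Wasserstein distance on $\mathcal P_2(\Omega)$ is $W_{2,d_\Omega}(C,C')=\bigl(\inf_\gamma\int d_\Omega(x,y)^2\,d\gamma(x,y)\bigr)^{1/2}$, the infimum being over couplings $\gamma$ of $C$ and $C'$. The quantity $\bar\kappa_{ij}$ is called the systematic-covariance ceiling of the pair. *)

theory Defs
  imports "HOL-Probability.Probability"
begin

text \<open>Class \<^class>\<open>polish_space\<close> is a complete, second countable metric type, so a type of sort
  \<open>{real_inner, polish_space}\<close> is a separable real Hilbert space.\<close>

definition self_adjoint :: "('h::real_inner \<Rightarrow>\<^sub>L 'h) \<Rightarrow> bool" where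
  "self_adjoint A \<longleftrightarrow> (\<forall>x y. blinfun_apply A x \<bullet> y = x \<bullet> blinfun_apply A y)"

definition positive_op :: "('h::real_inner \<Rightarrow>\<^sub>L 'h) \<Rightarrow> bool" where
  "positive_op A \<longleftrightarrow> self_adjoint A \<and> (\<forall>x. 0 \<le> blinfun_apply A x \<bullet> x)"

text \<open>Over the reals a nonnegative quadratic form does not force self-adjointness, so
  \<^const>\<open>positive_op\<close> demands it. On a Hilbert space every positive operator has exactly one
  positive square root; elsewhere the value below is arbitrary.\<close>

definition positive_sqrt :: "('h::real_inner \<Rightarrow>\<^sub>L 'h) \<Rightarrow> ('h \<Rightarrow>\<^sub>L 'h)" where
  "positive_sqrt A = (THE S. positive_op S \<and> S o\<^sub>L S = A)"

definition borel_embedding :: "('a::topological_space \<Rightarrow> 'b::topological_space) \<Rightarrow> bool" where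
  "borel_embedding f \<longleftrightarrow> f \<in> borel_measurable borel \<and> inj f \<and>
     the_inv f \<in> borel_measurable (restrict_space borel (range f))"

definition P2 :: "'a::metric_space measure set" where
  "P2 = {C. prob_space C \<and> sets C = sets borel \<and>
            (\<exists>x0. (\<integral>\<^sup>+x. ennreal ((dist x x0)\<^sup>2) \<partial>C) < \<infinity>)}"

definition couplings :: "'a measure \<Rightarrow> 'b measure \<Rightarrow> ('a \<times> 'b) measure set" where
  "couplings M N = {\<gamma>. sets \<gamma> = sets (M \<Otimes>\<^sub>M N) \<and> distr \<gamma> M fst = M \<and> distr \<gamma> N snd = N}"

text \<open>The infimum is taken in \<^typ>\<open>ennreal\<close>, where non-integrable costs count as infinite. The ground
  function \<open>d\<close> may be a pseudometric. The conversion to a real is harmless when the infimum is finite,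
  as it is for finite second moments.\<close>

definition wasserstein2_sq :: "('a \<Rightarrow> 'a \<Rightarrow> real) \<Rightarrow> 'a measure \<Rightarrow> 'a measure \<Rightarrow> real" where
  "wasserstein2_sq d M N =
     enn2real (INF \<gamma>\<in>couplings M N. \<integral>\<^sup>+z. ennreal ((d (fst z) (snd z))\<^sup>2) \<partial>\<gamma>)"

definition wasserstein2 :: "('a \<Rightarrow> 'a \<Rightarrow> real) \<Rightarrow> 'a measure \<Rightarrow> 'a measure \<Rightarrow> real" where
  "wasserstein2 d M N = sqrt (wasserstein2_sq d M N)"

definition weighted_dist :: "('h::real_inner \<Rightarrow>\<^sub>L 'h) \<Rightarrow> 'h \<Rightarrow> 'h \<Rightarrow> real" where
  "weighted_dist \<Gamma> b b' =
     norm (blinfun_apply (positive_sqrt \<Gamma>) b - blinfun_apply (positive_sqrt \<Gamma>) b')"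

text \<open>The library's \<open>indep_var\<close> only covers two random variables with the same value type.\<close>

definition indep_elements :: "'a measure \<Rightarrow> 'b measure \<Rightarrow> ('a \<Rightarrow> 'b) \<Rightarrow> 'c measure \<Rightarrow> ('a \<Rightarrow> 'c) \<Rightarrow> bool" where
  "indep_elements M N X K Y \<longleftrightarrow>
     prob_space.indep_set M {X -` A \<inter> space M | A. A \<in> sets N} {Y -` A \<inter> space M | A. A \<in> sets K}"

text \<open>Independence of characteristic and transmission draw is what makes the exposure law the mixture
  of the kernel \<open>x \<mapsto> distr Q borel (\<lambda>u. T (x, u))\<close> over the characteristic law.\<close>

lemma exposure_law_kernel:
  fixes X :: "'a \<Rightarrow> 'w::second_countable_topology" and T :: "'w \<times> 'u \<Rightarrow> 'h::topological_space"
  assumes "prob_space M" "X \<in> borel_measurable M" "U \<in> measurable M MU"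
    and "indep_elements M borel X MU U"
    and "T \<in> borel_measurable (borel \<Otimes>\<^sub>M MU)"
  shows "distr M borel (\<lambda>\<omega>. T (X \<omega>, U \<omega>)) =
    distr M borel X \<bind> (\<lambda>x. distr (distr M MU U) borel (\<lambda>u. T (x, u)))"
proof -
  interpret M: prob_space M by fact
  note [measurable] = assms(2,3,5)
  let ?C = "distr M borel X" and ?Q = "distr M MU U"
  interpret C: prob_space ?C by (rule M.prob_space_distr) measurable
  interpret Q: prob_space ?Q by (rule M.prob_space_distr) measurable
  interpret CQ: pair_prob_space ?C ?Q ..
  have "?C \<Otimes>\<^sub>M ?Q = distr M (borel \<Otimes>\<^sub>M MU) (\<lambda>\<omega>. (X \<omega>, U \<omega>))"
  proof (rule pair_measure_eqI)
    show "sigma_finite_measure ?C" "sigma_finite_measure ?Q" ..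
    show "sets (?C \<Otimes>\<^sub>M ?Q) = sets (distr M (borel \<Otimes>\<^sub>M MU) (\<lambda>\<omega>. (X \<omega>, U \<omega>)))"
      by (simp cong: sets_pair_measure_cong)
    fix A B assume "A \<in> sets ?C" "B \<in> sets ?Q"
    then have [measurable]: "A \<in> sets borel" "B \<in> sets MU" by simp_all
    have "M.prob ((X -` A \<inter> space M) \<inter> (U -` B \<inter> space M)) =
        M.prob (X -` A \<inter> space M) * M.prob (U -` B \<inter> space M)"
      using assms(4) by (intro M.indep_setD) (auto simp: indep_elements_def)
    moreover have "(\<lambda>\<omega>. (X \<omega>, U \<omega>)) -` (A \<times> B) \<inter> space M = (X -` A \<inter> space M) \<inter> (U -` B \<inter> space M)"
      by auto
    ultimately show "emeasure ?C A * emeasure ?Q B =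
        emeasure (distr M (borel \<Otimes>\<^sub>M MU) (\<lambda>\<omega>. (X \<omega>, U \<omega>))) (A \<times> B)"
      by (simp add: emeasure_distr M.emeasure_eq_measure ennreal_mult)
  qed
  then have "distr M borel (\<lambda>\<omega>. T (X \<omega>, U \<omega>)) = distr (?C \<Otimes>\<^sub>M ?Q) borel T"
    by (simp add: distr_distr o_def)
  also have "\<dots> = ?C \<bind> (\<lambda>x. distr ?Q borel (\<lambda>u. T (x, u)))"
  proof (rule measure_eqI)
    have K: "(\<lambda>x. distr ?Q borel (\<lambda>u. T (x, u))) \<in> measurable ?C (subprob_algebra borel)"
      by (rule measurable_distr2[where M=MU])
        (use Q.subprob_space_axioms in \<open>auto simp: space_subprob_algebra case_prod_beta'\<close>)
    show "sets (distr (?C \<Otimes>\<^sub>M ?Q) borel T) = sets (?C \<bind> (\<lambda>x. distr ?Q borel (\<lambda>u. T (x, u))))"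
      by (subst sets_bind[where N=borel]) auto
    fix A assume "A \<in> sets (distr (?C \<Otimes>\<^sub>M ?Q) borel T)"
    then have A[measurable]: "A \<in> sets borel" by simp
    have "emeasure (distr (?C \<Otimes>\<^sub>M ?Q) borel T) A = (\<integral>\<^sup>+x. \<integral>\<^sup>+u. indicator A (T (x, u)) \<partial>?Q \<partial>?C)"
    proof (subst Q.nn_integral_fst)
      have [measurable]: "T \<in> borel_measurable (?C \<Otimes>\<^sub>M ?Q)" by measurable
      show "(\<lambda>z. indicator A (T z) :: ennreal) \<in> borel_measurable (?C \<Otimes>\<^sub>M ?Q)" by measurable
      have "(\<integral>\<^sup>+z. indicator A (T z) \<partial>(?C \<Otimes>\<^sub>M ?Q)) = (\<integral>\<^sup>+y. indicator A y \<partial>distr (?C \<Otimes>\<^sub>M ?Q) borel T)"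
        by (subst nn_integral_distr) auto
      then show "emeasure (distr (?C \<Otimes>\<^sub>M ?Q) borel T) A = (\<integral>\<^sup>+z. indicator A (T z) \<partial>(?C \<Otimes>\<^sub>M ?Q))"
        by simp
    qed
    also have "\<dots> = (\<integral>\<^sup>+x. emeasure (distr ?Q borel (\<lambda>u. T (x, u))) A \<partial>?C)"
    proof (rule nn_integral_cong)
      fix x :: 'w
      have [measurable]: "(\<lambda>u. T (x, u)) \<in> borel_measurable ?Q" by measurable
      have "(\<integral>\<^sup>+u. indicator A (T (x, u)) \<partial>?Q) = (\<integral>\<^sup>+y. indicator A y \<partial>distr ?Q borel (\<lambda>u. T (x, u)))"
        by (subst nn_integral_distr) auto
      then show "(\<integral>\<^sup>+u. indicator A (T (x, u)) \<partial>?Q) = emeasure (distr ?Q borel (\<lambda>u. T (x, u))) A"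
        by simp
    qed
    also have "\<dots> = emeasure (?C \<bind> (\<lambda>x. distr ?Q borel (\<lambda>u. T (x, u)))) A"
      by (rule emeasure_bind[OF _ K A, symmetric]) simp
    finally show "emeasure (distr (?C \<Otimes>\<^sub>M ?Q) borel T) A =
      emeasure (?C \<bind> (\<lambda>x. distr ?Q borel (\<lambda>u. T (x, u)))) A" .
  qed
  finally show ?thesis .
qed

end

theory Submission
  imports Defs
begin

text \<open>A coupling of the characteristic laws yields one of the exposure laws, and conversely: extend
  it along the pairs \<open>(X\<^sub>i, B\<^sub>i)\<close> and \<open>(X\<^sub>j, B\<^sub>j)\<close>. On the extended space the bi-Lipschitz
  bounds and the error bounds hold pointwise and Minkowski's inequality carries them over to
  \<open>W\<^sub>2\<close>. It suffices to extend up to an arbitrarily small error.\<close>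

section \<open>Countable partitions and approximate gluing\<close>

text \<open>\<open>k\<close> selects the first term of a dense sequence at distance less than
  \<delta> / 2, so two points of one fibre are both that close to the same center. The fibres are
  the cells of the partition used for gluing.\<close>

lemma fine_countable_index:
  fixes \<delta> :: real
  assumes "\<delta> > 0"
  obtains k :: "'a::{metric_space, second_countable_topology} \<Rightarrow> nat"
  where "k \<in> measurable borel (count_space UNIV)" "\<And>x y. k x = k y \<Longrightarrow> dist x y < \<delta>"
proof -
  obtain D :: "'a set" where D: "countable D" "\<And>X. open X \<Longrightarrow> X \<noteq> {} \<Longrightarrow> \<exists>d\<in>D. d \<in> X"
    by (rule countable_dense_setE) blast
  have "D \<noteq> {}"
    using D(2)[of UNIV] by auto
  define c where "c = from_nat_into D"
  define k where "k x = (LEAST n. dist x (c n) < \<delta> / 2)" for x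
  have "\<exists>n. dist x (c n) < \<delta> / 2" for x
  proof -
    obtain y where "y \<in> D" "y \<in> ball x (\<delta> / 2)"
      using D(2)[of "ball x (\<delta> / 2)"] \<open>\<delta> > 0\<close> by auto
    with from_nat_into_surj[OF D(1)] show ?thesis
      unfolding c_def by (metis mem_ball)
  qed
  then have k: "dist x (c (k x)) < \<delta> / 2" for x
    unfolding k_def by (rule LeastI_ex)
  show thesis
  proof
    show "k \<in> measurable borel (count_space UNIV)"
      unfolding k_def by measurable
    show "dist x y < \<delta>" if "k x = k y" for x y
      using k[of x] k[of y] that dist_triangle2[of x y "c (k x)"] by simp
  qed
qed

text \<open>There are only countably many fibres, so the union of those of measure zero is a null
  set. This keeps the divisor in the conditional weights away from zero almost everywhere.\<close>

lemma AE_discrete_fibre_nonnull: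
  fixes k :: "'a \<Rightarrow> 'n::countable"
  assumes [measurable]: "k \<in> measurable M (count_space UNIV)"
  shows "AE \<omega> in M. emeasure M {\<omega>' \<in> space M. k \<omega>' = k \<omega>} \<noteq> 0"
proof -
  have "AE \<omega> in M. k \<omega> = n \<longrightarrow> emeasure M {\<omega>' \<in> space M. k \<omega>' = n} \<noteq> 0" for n
  proof (cases "emeasure M {\<omega>' \<in> space M. k \<omega>' = n} = 0")
    case True
    then show ?thesis
      by (intro AE_I[of _ _ "{\<omega>' \<in> space M. k \<omega>' = n}"]) auto
  qed simp
  then have "AE \<omega> in M. \<forall>n. k \<omega> = n \<longrightarrow> emeasure M {\<omega>' \<in> space M. k \<omega>' = n} \<noteq> 0"
    unfolding AE_all_countable by blast
  then show ?thesis
    by eventually_elim blast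
qed

text \<open>For fixed \<omega> the integrand is the reciprocal mass of the fibre of \<open>k\<close>
  over \<open>h \<omega>\<close>, supported on that very fibre, so it integrates to 1 once the fibre
  has positive mass. This makes both marginals of the glued measure correct.\<close>

lemma (in prob_space) nn_integral_matching_weight:
  fixes h :: "'b \<Rightarrow> 'n::countable" and k :: "'a \<Rightarrow> 'n"
  assumes [measurable]: "h \<in> measurable N (count_space UNIV)" "k \<in> measurable M (count_space UNIV)"
    and eq: "\<And>n. emeasure N {\<omega> \<in> space N. h \<omega> = n} = emeasure M {\<omega> \<in> space M. k \<omega> = n}"
  shows "AE \<omega> in N. (\<integral>\<^sup>+r. (if h \<omega> = k r then 1 / emeasure M {\<omega>' \<in> space M. k \<omega>' = k r} else 0) \<partial>M) = 1"
  using AE_discrete_fibre_nonnull[OF assms(1)]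
proof eventually_elim
  case (elim \<omega>)
  let ?E = "{\<omega>' \<in> space M. k \<omega>' = h \<omega>}"
  have "(\<integral>\<^sup>+r. (if h \<omega> = k r then 1 / emeasure M {\<omega>' \<in> space M. k \<omega>' = k r} else 0) \<partial>M)
      = (\<integral>\<^sup>+r. 1 / emeasure M ?E * indicator ?E r \<partial>M)"
    by (intro nn_integral_cong) (auto simp: indicator_def)
  also have "\<dots> = 1 / emeasure M ?E * emeasure M ?E"
    by (rule nn_integral_cmult_indicator) measurable
  \<comment> \<open>Cancellation in \<open>ennreal\<close> needs the mass to be nonzero, which comes
    from \<open>elim\<close> through \<open>eq\<close>, and finite, which holds in a probability
    space.\<close>
  also have "\<dots> = 1"
    using elim eq[of "h \<omega>"] by (simp add: ennreal_divide_times ennreal_divide_self less_top[symmetric])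
  finally show ?case .
qed

text \<open>Gluing along a common law without disintegration: conditioning on the cells of a countable
  partition into sets of diameter less than \<open>\<delta>\<close> is elementary, and it matches \<open>f\<close> and \<open>g\<close>
  up to \<open>\<delta>\<close>.\<close>

lemma approximate_gluing:
  fixes f :: "'a \<Rightarrow> 'h::{metric_space, second_countable_topology}" and g :: "'b \<Rightarrow> 'h"
  assumes "prob_space M" "prob_space R"
    and f[measurable]: "f \<in> borel_measurable M" and g[measurable]: "g \<in> borel_measurable R"
    and law: "distr M borel f = distr R borel g"
    and "\<delta> > 0"
  obtains \<theta> where "\<theta> \<in> couplings M R" "AE z in \<theta>. dist (f (fst z)) (g (snd z)) < \<delta>"
proof -
  interpret M: prob_space M by fact
  interpret R: prob_space R by fact
  interpret MR: pair_prob_space M R ..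
  obtain k :: "'h \<Rightarrow> nat" where k[measurable]: "k \<in> measurable borel (count_space UNIV)"
    and k_close: "\<And>x y. k x = k y \<Longrightarrow> dist x y < \<delta>"
    by (rule fine_countable_index[OF \<open>\<delta> > 0\<close>]) blast
  \<comment> \<open>Here the hypothesis \<open>law\<close> enters: each cell has the same mass under
    both measures.\<close>
  have p: "emeasure M {\<omega> \<in> space M. k (f \<omega>) = n} = emeasure R {r \<in> space R. k (g r) = n}" for n
  proof -
    have "{x. k x = n} \<in> sets borel"
      by measurable
    then have "emeasure (distr M borel f) {x. k x = n} = emeasure M {\<omega> \<in> space M. k (f \<omega>) = n}"
      "emeasure (distr R borel g) {x. k x = n} = emeasure R {r \<in> space R. k (g r) = n}"
      by (auto simp: emeasure_distr intro!: arg_cong2[where f=emeasure])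
    with law show ?thesis by simp
  qed
  \<comment> \<open>A cell of mass zero receives the value infinity; such cells are met with
    probability zero.\<close>
  define q where "q n = 1 / emeasure R {r \<in> space R. k (g r) = n}" for n
  \<comment> \<open>Equality of the two indices is a countable union of measurable
    rectangles.\<close>
  have "Measurable.pred (M \<Otimes>\<^sub>M R) (\<lambda>z. \<exists>n. k (f (fst z)) = n \<and> k (g (snd z)) = n)"
    by measurable
  then have [measurable]: "Measurable.pred (M \<Otimes>\<^sub>M R) (\<lambda>z. k (f (fst z)) = k (g (snd z)))"
    by (simp add: eq_commute)
  have [measurable]: "(\<lambda>z. q (k (g (snd z)))) \<in> borel_measurable (M \<Otimes>\<^sub>M R)"
    by (rule measurable_compose[where g=q and N="count_space UNIV"]) simp_all
  \<comment> \<open>Under this density relative to the product, the two coordinates share their cell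
    and are independent given that cell.\<close>
  define w where "w z = (if k (f (fst z)) = k (g (snd z)) then q (k (g (snd z))) else 0)" for z
  have [measurable]: "w \<in> borel_measurable (M \<Otimes>\<^sub>M R)"
    unfolding w_def by measurable
  have wR: "AE \<omega> in M. (\<integral>\<^sup>+r. w (\<omega>, r) \<partial>R) = 1"
    using R.nn_integral_matching_weight[of "\<lambda>\<omega>. k (f \<omega>)" M "\<lambda>r. k (g r)"] p
    by (simp add: w_def q_def cong: if_cong)
  have wM: "AE r in R. (\<integral>\<^sup>+\<omega>. w (\<omega>, r) \<partial>M) = 1"
  proof -
    \<comment> \<open>By \<open>p\<close> the cell masses may be taken under \<open>M\<close>
      instead of \<open>R\<close>, so the weight is symmetric in the two factors and the integral
      lemma applies in the other direction.\<close>
    have "w (\<omega>, r) = (if k (g r) = k (f \<omega>) then 1 / emeasure M {\<omega>' \<in> space M. k (f \<omega>') = k (f \<omega>)} else 0)"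
      for \<omega> r
      by (auto simp: w_def q_def p)
    then show ?thesis
      using M.nn_integral_matching_weight[of "\<lambda>r. k (g r)" R "\<lambda>\<omega>. k (f \<omega>)"] p by simp
  qed
  define \<theta> where "\<theta> = density (M \<Otimes>\<^sub>M R) w"
  have [measurable_cong]: "sets \<theta> = sets (M \<Otimes>\<^sub>M R)"
    by (simp add: \<theta>_def)
  \<comment> \<open>By Tonelli, integrating out the second coordinate multiplies the indicator by
    the inner integral of \<open>w\<close>, which is 1 almost everywhere by \<open>wR\<close>. The
    other marginal is symmetric, with \<open>wM\<close>.\<close>
  have "distr \<theta> M fst = M"
  proof (rule measure_eqI)
    fix A assume "A \<in> sets (distr \<theta> M fst)"
    then have [measurable]: "A \<in> sets M" by simp
    have "emeasure (distr \<theta> M fst) A = (\<integral>\<^sup>+z. indicator A z \<partial>distr \<theta> M fst)"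
      by simp
    also have "\<dots> = (\<integral>\<^sup>+z. indicator A (fst z) \<partial>\<theta>)"
      by (rule nn_integral_distr) measurable
    also have "\<dots> = (\<integral>\<^sup>+z. w z * indicator A (fst z) \<partial>(M \<Otimes>\<^sub>M R))"
      unfolding \<theta>_def by (rule nn_integral_density) measurable
    also have "\<dots> = (\<integral>\<^sup>+\<omega>. (\<integral>\<^sup>+r. w (\<omega>, r) * indicator A \<omega> \<partial>R) \<partial>M)"
      by (subst R.nn_integral_fst[symmetric]) auto
    also have "\<dots> = (\<integral>\<^sup>+\<omega>. (\<integral>\<^sup>+r. w (\<omega>, r) \<partial>R) * indicator A \<omega> \<partial>M)"
      by (intro nn_integral_cong nn_integral_multc) measurable
    also have "\<dots> = (\<integral>\<^sup>+\<omega>. indicator A \<omega> \<partial>M)"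
      by (intro nn_integral_cong_AE) (use wR in eventually_elim, simp)
    finally show "emeasure (distr \<theta> M fst) A = emeasure M A"
      by simp
  qed simp
  moreover have "distr \<theta> R snd = R"
  proof (rule measure_eqI)
    fix A assume "A \<in> sets (distr \<theta> R snd)"
    then have [measurable]: "A \<in> sets R" by simp
    have "emeasure (distr \<theta> R snd) A = (\<integral>\<^sup>+z. indicator A z \<partial>distr \<theta> R snd)"
      by simp
    also have "\<dots> = (\<integral>\<^sup>+z. indicator A (snd z) \<partial>\<theta>)"
      by (rule nn_integral_distr) measurable
    also have "\<dots> = (\<integral>\<^sup>+z. w z * indicator A (snd z) \<partial>(M \<Otimes>\<^sub>M R))"
      unfolding \<theta>_def by (rule nn_integral_density) measurable
    also have "\<dots> = (\<integral>\<^sup>+r. (\<integral>\<^sup>+\<omega>. w (\<omega>, r) * indicator A r \<partial>M) \<partial>R)"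
      by (subst MR.nn_integral_snd[symmetric]) (auto simp: case_prod_beta')
    also have "\<dots> = (\<integral>\<^sup>+r. (\<integral>\<^sup>+\<omega>. w (\<omega>, r) \<partial>M) * indicator A r \<partial>R)"
      by (intro nn_integral_cong nn_integral_multc) measurable
    also have "\<dots> = (\<integral>\<^sup>+r. indicator A r \<partial>R)"
      by (intro nn_integral_cong_AE) (use wM in eventually_elim, simp)
    finally show "emeasure (distr \<theta> R snd) A = emeasure R A"
      by simp
  qed simp
  ultimately have "\<theta> \<in> couplings M R"
    by (simp add: couplings_def \<theta>_def)
  \<comment> \<open>The density vanishes unless the two cells coincide, so \<open>k_close\<close>
    applies almost everywhere.\<close>
  moreover have "AE z in \<theta>. dist (f (fst z)) (g (snd z)) < \<delta>"
    unfolding \<theta>_def by (subst AE_density) (auto simp: w_def intro!: AE_I2 k_close split: if_splits)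
  ultimately show thesis
    using that by blast
qed

section \<open>A Minkowski bound on a probability space\<close>

text \<open>Minkowski's inequality in L2 for \<open>a * h\<close> and the constant \<open>c\<close>.
  After expanding the square only the cross term needs an estimate: the mean of \<open>h\<close> is
  at most its L2 norm, by nonnegativity of the variance.\<close>

lemma (in prob_space) nn_integral_affine_square_le:
  fixes h :: "'a \<Rightarrow> real"
  assumes [measurable]: "h \<in> borel_measurable M" and h: "\<And>x. 0 \<le> h x" and ac: "0 \<le> a" "0 \<le> c"
    and fin: "(\<integral>\<^sup>+x. ennreal ((h x)\<^sup>2) \<partial>M) = ennreal I" and I: "0 \<le> I"
  shows "(\<integral>\<^sup>+x. ennreal ((a * h x + c)\<^sup>2) \<partial>M) \<le> ennreal ((a * sqrt I + c)\<^sup>2)"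
proof -
  have int2: "integrable M (\<lambda>x. (h x)\<^sup>2)"
    by (rule integrableI_nonneg) (auto simp: fin)
  then have int: "integrable M h"
    by (rule square_integrable_imp_integrable[rotated]) measurable
  have I_eq: "expectation (\<lambda>x. (h x)\<^sup>2) = I"
    by (rule integral_eq_nn_integral[THEN trans]) (auto simp: fin I)
  have "0 \<le> variance h"
    by (rule variance_positive)
  then have "(expectation h)\<^sup>2 \<le> I"
    by (simp add: variance_eq[OF int int2] I_eq)
  then have E: "expectation h \<le> sqrt I"
    by (rule real_le_rsqrt)
  have "integrable M (\<lambda>x. (a * h x + c)\<^sup>2)"
    using int int2 by (simp add: power2_sum power_mult_distrib)
  then have "(\<integral>\<^sup>+x. ennreal ((a * h x + c)\<^sup>2) \<partial>M) = ennreal (expectation (\<lambda>x. (a * h x + c)\<^sup>2))"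
    by (intro nn_integral_eq_integral) auto
  also have "expectation (\<lambda>x. (a * h x + c)\<^sup>2) = a\<^sup>2 * I + 2 * a * c * expectation h + c\<^sup>2"
    using int int2 by (simp add: power2_sum power_mult_distrib I_eq prob_space)
  also have "\<dots> \<le> a\<^sup>2 * I + 2 * a * c * sqrt I + c\<^sup>2"
    using E ac by (intro add_mono mult_left_mono) auto
  also have "\<dots> = (a * sqrt I + c)\<^sup>2"
    using I by (simp add: power2_sum power_mult_distrib)
  finally show ?thesis
    by (simp add: ennreal_leI)
qed

section \<open>Couplings and their marginals\<close>

lemma couplings_measurable:
  assumes "\<gamma> \<in> couplings M N"
  shows "fst \<in> measurable \<gamma> M" "snd \<in> measurable \<gamma> N"
proof -
  have [measurable_cong]: "sets \<gamma> = sets (M \<Otimes>\<^sub>M N)"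
    using assms by (simp add: couplings_def)
  show "fst \<in> measurable \<gamma> M" "snd \<in> measurable \<gamma> N"
    by measurable
qed

lemma prob_space_coupling:
  assumes "\<gamma> \<in> couplings M N" "prob_space M"
  shows "prob_space \<gamma>"
  using assms couplings_measurable[OF assms(1)] prob_space_distrD[of fst \<gamma> M]
  by (simp add: couplings_def)

lemma distr_coupling:
  assumes "\<gamma> \<in> couplings M N"
  shows "f \<in> measurable M K \<Longrightarrow> distr \<gamma> K (\<lambda>z. f (fst z)) = distr M K f"
    and "g \<in> measurable N K \<Longrightarrow> distr \<gamma> K (\<lambda>z. g (snd z)) = distr N K g"
proof -
  show "distr \<gamma> K (\<lambda>z. f (fst z)) = distr M K f" if "f \<in> measurable M K"
    using distr_distr[OF that couplings_measurable(1)[OF assms]] assms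
    by (simp add: couplings_def o_def)
  show "distr \<gamma> K (\<lambda>z. g (snd z)) = distr N K g" if "g \<in> measurable N K"
    using distr_distr[OF that couplings_measurable(2)[OF assms]] assms
    by (simp add: couplings_def o_def)
qed

section \<open>Transfer of couplings and of Wasserstein distances\<close>

text \<open>The coupling \<gamma> lives on the values of \<open>f\<close> and \<open>g\<close>,
  whereas \<open>bound\<close> compares points of \<open>M\<close> and \<open>N\<close>. Gluing
  \<open>M\<close> to the first coordinate of \<gamma> and \<open>N\<close> to the second gives a
  common space on which \<open>bound\<close> can be used. The gluing is exact only up to \<delta>,
  and \<open>lip\<close> controls the resulting change of \<open>d\<close>.\<close>

lemma coupling_transfer:
  fixes f :: "'a \<Rightarrow> 'h::{metric_space, second_countable_topology}" and g :: "'b \<Rightarrow> 'h"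
    and d :: "'h \<Rightarrow> 'h \<Rightarrow> real" and d' :: "'k \<Rightarrow> 'l \<Rightarrow> real"
  assumes M: "prob_space M" and N: "prob_space N"
    and [measurable]: "f \<in> borel_measurable M" "g \<in> borel_measurable N"
    and [measurable]: "F \<in> measurable M K" "G \<in> measurable N K'"
    and [measurable]: "(\<lambda>z. d (fst z) (snd z)) \<in> borel_measurable (borel \<Otimes>\<^sub>M borel)"
      "(\<lambda>z. d' (fst z) (snd z)) \<in> borel_measurable (K \<Otimes>\<^sub>M K')"
    and d: "\<And>x y. 0 \<le> d x y" and d': "\<And>x y. 0 \<le> d' x y"
    and lip: "\<And>x y x' y'. d x' y' \<le> d x y + l * (dist x' x + dist y' y)"
    and bound: "\<And>\<omega> \<omega>'. \<omega> \<in> space M \<Longrightarrow> \<omega>' \<in> space N \<Longrightarrow>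
        d' (F \<omega>) (G \<omega>') \<le> a * d (f \<omega>) (g \<omega>') + c"
    and nonneg: "0 \<le> a" "0 \<le> c" "0 \<le> l" and \<delta>: "0 < \<delta>"
    and \<gamma>: "\<gamma> \<in> couplings (distr M borel f) (distr N borel g)"
    and I: "(\<integral>\<^sup>+z. ennreal ((d (fst z) (snd z))\<^sup>2) \<partial>\<gamma>) = ennreal I" "0 \<le> I"
  obtains \<eta> where "\<eta> \<in> couplings (distr M K F) (distr N K' G)"
    "(\<integral>\<^sup>+z. ennreal ((d' (fst z) (snd z))\<^sup>2) \<partial>\<eta>) \<le> ennreal ((a * sqrt I + (2 * a * l * \<delta> + c))\<^sup>2)"
proof -
  interpret M: prob_space M by fact
  interpret N: prob_space N by fact
  have [measurable_cong]: "sets \<gamma> = sets (borel \<Otimes>\<^sub>M borel)"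
    using \<gamma> by (auto simp: couplings_def cong: sets_pair_measure_cong)
  interpret \<gamma>: prob_space \<gamma>
    by (rule prob_space_coupling[OF \<gamma>]) (intro M.prob_space_distr, measurable)
  \<comment> \<open>Each marginal is presented as the law of a coordinate under \<gamma>, the form
    that gluing requires.\<close>
  have "distr M borel f = distr \<gamma> borel fst" "distr N borel g = distr \<gamma> borel snd"
    using distr_coupling(1)[OF \<gamma>, of "\<lambda>x. x" borel] distr_coupling(2)[OF \<gamma>, of "\<lambda>x. x" borel]
    by (simp_all add: distr_distr o_def)
  note law = this
  obtain \<theta> where \<theta>: "\<theta> \<in> couplings M \<gamma>" "AE z in \<theta>. dist (f (fst z)) (fst (snd z)) < \<delta>"
    using approximate_gluing[OF M \<gamma>.prob_space_axioms _ _ law(1) \<delta>] by auto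
  have [measurable_cong]: "sets \<theta> = sets (M \<Otimes>\<^sub>M \<gamma>)"
    using \<theta> by (simp add: couplings_def)
  interpret \<theta>: prob_space \<theta>
    by (rule prob_space_coupling[OF \<theta>(1) M])
  \<comment> \<open>Attaching \<open>M\<close> leaves the law of the second coordinate of \<gamma>
    unchanged, so \<open>N\<close> can be glued to the enlarged space.\<close>
  have "distr N borel g = distr \<theta> borel (\<lambda>z. snd (snd z))"
    using distr_coupling(2)[OF \<theta>(1), of snd borel] law(2) by simp
  then obtain \<theta>' where \<theta>': "\<theta>' \<in> couplings N \<theta>" "AE z in \<theta>'. dist (g (fst z)) (snd (snd (snd z))) < \<delta>"
    using approximate_gluing[OF N \<theta>.prob_space_axioms _ _ _ \<delta>, of g "\<lambda>z. snd (snd z)"] by auto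
  \<comment> \<open>Points of \<open>\<theta>'\<close> have the form (\<omega>', (\<omega>, (x, y)))
    with \<omega>' in \<open>N\<close>, \<omega> in \<open>M\<close> and (x, y) distributed by
    \<gamma>.\<close>
  have [measurable_cong]: "sets \<theta>' = sets (N \<Otimes>\<^sub>M \<theta>)"
    using \<theta>' by (simp add: couplings_def)
  have "distr \<theta>' \<theta> snd = \<theta>"
    using \<theta>'(1) by (simp add: couplings_def)
  with \<theta>(2) have "AE z in distr \<theta>' \<theta> snd. dist (f (fst z)) (fst (snd z)) < \<delta>"
    by metis
  then have close1: "AE z in \<theta>'. dist (f (fst (snd z))) (fst (snd (snd z))) < \<delta>"
    by (rule AE_distrD[rotated]) measurable
  \<comment> \<open>\<open>N\<close> was glued last and stands first in \<open>\<theta>'\<close>;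
    the image restores the order of \<open>F\<close> and \<open>G\<close>.\<close>
  define \<eta> where "\<eta> = distr \<theta>' (K \<Otimes>\<^sub>M K') (\<lambda>z. (F (fst (snd z)), G (fst z)))"
  have "distr \<eta> K fst = distr M K F"
    using distr_coupling(2)[OF \<theta>'(1), of "\<lambda>z. F (fst z)" K] distr_coupling(1)[OF \<theta>(1), of F K]
    by (simp add: \<eta>_def distr_distr o_def)
  moreover have "distr \<eta> K' snd = distr N K' G"
    using distr_coupling(1)[OF \<theta>'(1), of G K'] by (simp add: \<eta>_def distr_distr o_def)
  ultimately have "\<eta> \<in> couplings (distr M K F) (distr N K' G)"
    by (simp add: couplings_def \<eta>_def cong: distr_cong sets_pair_measure_cong)
  moreover have "(\<integral>\<^sup>+z. ennreal ((d' (fst z) (snd z))\<^sup>2) \<partial>\<eta>) \<le> ennreal ((a * sqrt I + (2 * a * l * \<delta> + c))\<^sup>2)"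
  proof -
    have "(\<integral>\<^sup>+z. ennreal ((d' (fst z) (snd z))\<^sup>2) \<partial>\<eta>)
        = (\<integral>\<^sup>+z. ennreal ((d' (F (fst (snd z))) (G (fst z)))\<^sup>2) \<partial>\<theta>')"
      unfolding \<eta>_def by (subst nn_integral_distr) auto
    also have "\<dots> \<le> (\<integral>\<^sup>+z. ennreal ((a * d (fst (snd (snd z))) (snd (snd (snd z))) + (2 * a * l * \<delta> + c))\<^sup>2) \<partial>\<theta>')"
    proof (rule nn_integral_mono_AE)
      show "AE z in \<theta>'. ennreal ((d' (F (fst (snd z))) (G (fst z)))\<^sup>2)
        \<le> ennreal ((a * d (fst (snd (snd z))) (snd (snd (snd z))) + (2 * a * l * \<delta> + c))\<^sup>2)"
        using close1 \<theta>'(2) AE_space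
      proof eventually_elim
        case (elim z)
        let ?x = "fst (snd (snd z))" and ?y = "snd (snd (snd z))"
        have "fst z \<in> space N" "fst (snd z) \<in> space M"
          using elim(3) sets_eq_imp_space_eq[OF \<open>sets \<theta>' = _\<close>] sets_eq_imp_space_eq[OF \<open>sets \<theta> = _\<close>]
          by (auto simp: space_pair_measure)
        then have "d' (F (fst (snd z))) (G (fst z)) \<le> a * d (f (fst (snd z))) (g (fst z)) + c"
          by (rule bound[rotated])
        \<comment> \<open>Passing from the values of \<open>f\<close> and \<open>g\<close> to
          \<open>?x\<close> and \<open>?y\<close> costs at most
          \<open>l * (\<delta> + \<delta>)\<close> by \<open>lip\<close>; multiplied by
          \<open>a\<close> this is the term \<open>2 * a * l * \<delta>\<close>.\<close>
        also have "\<dots> \<le> a * (d ?x ?y + l * (\<delta> + \<delta>)) + c"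
          using elim(1,2) nonneg
          by (intro add_right_mono mult_left_mono order_trans[OF lip[of _ _ ?x ?y]] add_left_mono add_mono) auto
        finally show ?case
          by (intro ennreal_leI power_mono d') (simp add: algebra_simps)
      qed
    qed
    also have "\<dots> = (\<integral>\<^sup>+z. ennreal ((a * d (fst z) (snd z) + (2 * a * l * \<delta> + c))\<^sup>2) \<partial>distr \<theta>' \<gamma> (\<lambda>z. snd (snd z)))"
      by (subst nn_integral_distr) auto
    also have "distr \<theta>' \<gamma> (\<lambda>z. snd (snd z)) = \<gamma>"
      using distr_coupling(2)[OF \<theta>'(1), of snd \<gamma>] \<theta>(1) by (simp add: couplings_def)
    also have "(\<integral>\<^sup>+z. ennreal ((a * d (fst z) (snd z) + (2 * a * l * \<delta> + c))\<^sup>2) \<partial>\<gamma>)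
        \<le> ennreal ((a * sqrt I + (2 * a * l * \<delta> + c))\<^sup>2)"
      using nonneg \<delta> d I by (intro \<gamma>.nn_integral_affine_square_le) auto
    finally show ?thesis .
  qed
  ultimately show thesis
    using that by blast
qed

text \<open>The transfer is applied to couplings whose cost approaches the infimum, and the error is
  sent to zero. Finiteness is a separate conclusion because \<open>enn2real\<close> sends infinity
  to 0; it lets the lemma be applied again with the roles exchanged.\<close>

lemma wasserstein2_affine_transfer:
  fixes f :: "'a \<Rightarrow> 'h::{metric_space, second_countable_topology}" and g :: "'b \<Rightarrow> 'h"
    and d :: "'h \<Rightarrow> 'h \<Rightarrow> real" and d' :: "'k \<Rightarrow> 'k \<Rightarrow> real"
  assumes M: "prob_space M" and N: "prob_space N"
    and fg: "f \<in> borel_measurable M" "g \<in> borel_measurable N"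
    and FG: "F \<in> measurable M K" "G \<in> measurable N K'"
    and meas: "(\<lambda>z. d (fst z) (snd z)) \<in> borel_measurable (borel \<Otimes>\<^sub>M borel)"
      "(\<lambda>z. d' (fst z) (snd z)) \<in> borel_measurable (K \<Otimes>\<^sub>M K')"
    and d: "\<And>x y. 0 \<le> d x y" and d': "\<And>x y. 0 \<le> d' x y"
    and lip: "\<And>x y x' y'. d x' y' \<le> d x y + l * (dist x' x + dist y' y)"
    and bound: "\<And>\<omega> \<omega>'. \<omega> \<in> space M \<Longrightarrow> \<omega>' \<in> space N \<Longrightarrow>
        d' (F \<omega>) (G \<omega>') \<le> a * d (f \<omega>) (g \<omega>') + c"
    and nonneg: "0 \<le> a" "0 \<le> c" "0 \<le> l"
    and fin: "(INF \<gamma>\<in>couplings (distr M borel f) (distr N borel g).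
        \<integral>\<^sup>+z. ennreal ((d (fst z) (snd z))\<^sup>2) \<partial>\<gamma>) < \<infinity>" (is "?W < \<infinity>")
  shows "(INF \<eta>\<in>couplings (distr M K F) (distr N K' G).
        \<integral>\<^sup>+z. ennreal ((d' (fst z) (snd z))\<^sup>2) \<partial>\<eta>) < \<infinity>" (is "?W' < \<infinity>")
    and "wasserstein2 d' (distr M K F) (distr N K' G)
      \<le> a * wasserstein2 d (distr M borel f) (distr N borel g) + c" (is "?w' \<le> a * ?w + c")
proof -
  have w: "?w = sqrt (enn2real ?W)" "?w' = sqrt (enn2real ?W')"
    by (simp_all add: wasserstein2_def wasserstein2_sq_def)
  have "0 \<le> ?w"
    by (simp add: w)
  \<comment> \<open>The same \<open>e\<close> serves as slack above the infimum and as gluing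
    error.\<close>
  have *: "?W' \<le> ennreal ((a * (?w + e) + (2 * a * l * e + c))\<^sup>2)" if e: "0 < e" for e
  proof -
    \<comment> \<open>By \<open>fin\<close>, the real number \<open>?w\<close> still determines the
      infimum.\<close>
    have "?W = ennreal (?w\<^sup>2)"
      using fin by (simp add: w)
    also have "\<dots> < ennreal ((?w + e)\<^sup>2)"
      using e \<open>0 \<le> ?w\<close> by (intro ennreal_lessI power_strict_mono zero_less_power) auto
    finally obtain \<gamma> where \<gamma>: "\<gamma> \<in> couplings (distr M borel f) (distr N borel g)"
      "(\<integral>\<^sup>+z. ennreal ((d (fst z) (snd z))\<^sup>2) \<partial>\<gamma>) < ennreal ((?w + e)\<^sup>2)"
      by (auto simp: INF_less_iff)
    then obtain I where I: "(\<integral>\<^sup>+z. ennreal ((d (fst z) (snd z))\<^sup>2) \<partial>\<gamma>) = ennreal I" "0 \<le> I"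
      by (cases "\<integral>\<^sup>+z. ennreal ((d (fst z) (snd z))\<^sup>2) \<partial>\<gamma>") auto
    then have "I \<le> (?w + e)\<^sup>2"
      using \<gamma>(2) by (simp add: ennreal_less_iff)
    then have "sqrt I \<le> ?w + e"
      using \<open>0 \<le> ?w\<close> e by (intro real_le_lsqrt) auto
    obtain \<eta> where \<eta>: "\<eta> \<in> couplings (distr M K F) (distr N K' G)"
      "(\<integral>\<^sup>+z. ennreal ((d' (fst z) (snd z))\<^sup>2) \<partial>\<eta>) \<le> ennreal ((a * sqrt I + (2 * a * l * e + c))\<^sup>2)"
      using coupling_transfer[OF M N fg FG meas d d' lip bound nonneg e \<gamma>(1) I] by blast
    have "?W' \<le> ennreal ((a * sqrt I + (2 * a * l * e + c))\<^sup>2)"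
      using \<eta> by (rule INF_lower2)
    also have "\<dots> \<le> ennreal ((a * (?w + e) + (2 * a * l * e + c))\<^sup>2)"
      using \<open>sqrt I \<le> ?w + e\<close> nonneg e I(2)
      by (intro ennreal_leI power_mono add_right_mono mult_left_mono) auto
    finally show ?thesis .
  qed
  show "?W' < \<infinity>"
    using *[OF zero_less_one] by (rule le_less_trans) simp
  have le: "?w' \<le> a * ?w + c + e * (a + 2 * a * l)" if "0 < e" for e
  proof -
    have "enn2real ?W' \<le> (a * (?w + e) + (2 * a * l * e + c))\<^sup>2"
      using *[OF that] by (intro enn2real_leI) auto
    then have "?w' \<le> a * (?w + e) + (2 * a * l * e + c)"
      unfolding w(2) using nonneg that \<open>0 \<le> ?w\<close> by (intro real_le_lsqrt) auto
    then show ?thesis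
      by (simp add: algebra_simps)
  qed
  show "?w' \<le> a * ?w + c"
  proof (rule field_le_epsilon)
    fix e :: real assume "0 < e"
    \<comment> \<open>\<open>b\<close> is the total coefficient of the error; dividing by
      \<open>b + 1\<close> also covers the case that \<open>b\<close> is zero.\<close>
    define b where "b = a + 2 * a * l"
    have "0 \<le> b"
      using nonneg by (simp add: b_def)
    then have "e / (b + 1) * b \<le> e"
      using \<open>0 < e\<close> by (simp add: field_simps)
    with le[of "e / (b + 1)"] \<open>0 < e\<close> \<open>0 \<le> b\<close> show "?w' \<le> a * ?w + c + e"
      by (simp add: b_def[symmetric])
  qed
qed

section \<open>Finite transport cost between laws with second moments\<close>

lemma pair_measure_in_couplings:
  assumes "prob_space M" "prob_space N"
  shows "M \<Otimes>\<^sub>M N \<in> couplings M N"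
proof -
  interpret M: prob_space M by fact
  interpret N: prob_space N by fact
  interpret pair_prob_space M N ..
  have "distr (M \<Otimes>\<^sub>M N) M fst = M"
    by (rule N.distr_pair_fst)
  moreover have "distr (M \<Otimes>\<^sub>M N) N snd = N"
  proof (rule measure_eqI)
    fix A assume "A \<in> sets (distr (M \<Otimes>\<^sub>M N) N snd)"
    then have A[measurable]: "A \<in> sets N" by simp
    have "emeasure (distr (M \<Otimes>\<^sub>M N) N snd) A = emeasure (M \<Otimes>\<^sub>M N) (space M \<times> A)"
      using sets.sets_into_space[OF A]
      by (auto simp: emeasure_distr space_pair_measure intro!: arg_cong2[where f=emeasure])
    also have "\<dots> = emeasure N A"
      by (simp add: N.emeasure_pair_measure_Times M.emeasure_space_1)
    finally show "emeasure (distr (M \<Otimes>\<^sub>M N) N snd) A = emeasure N A" .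
  qed simp
  ultimately show ?thesis
    by (simp add: couplings_def)
qed

text \<open>The product coupling already has finite cost, by the triangle inequality through the two
  base points. Hence \<open>enn2real\<close> loses nothing in the distance between the
  characteristic laws.\<close>

lemma INF_couplings_dist_sq_finite:
  fixes C C' :: "'w::{metric_space, second_countable_topology} measure"
  assumes "C \<in> P2" "C' \<in> P2"
  shows "(INF \<gamma>\<in>couplings C C'. \<integral>\<^sup>+z. ennreal ((dist (fst z) (snd z))\<^sup>2) \<partial>\<gamma>) < \<infinity>"
proof -
  obtain x0 y0 where C: "prob_space C" "prob_space C'"
    and [measurable_cong]: "sets C = sets borel" "sets C' = sets borel"
    and fin: "(\<integral>\<^sup>+x. ennreal ((dist x x0)\<^sup>2) \<partial>C) < \<infinity>" "(\<integral>\<^sup>+x. ennreal ((dist x y0)\<^sup>2) \<partial>C') < \<infinity>"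
    using assms by (auto simp: P2_def)
  interpret C: prob_space C by fact
  interpret C': prob_space C' by fact
  interpret CC: pair_prob_space C C' ..
  have split: "ennreal ((dist x y)\<^sup>2) \<le>
      3 * ennreal ((dist x x0)\<^sup>2) + 3 * ennreal ((dist x0 y0)\<^sup>2) + 3 * ennreal ((dist y y0)\<^sup>2)" for x y
  proof -
    \<comment> \<open>The right side minus the left is the sum of the squares of the three pairwise
      differences.\<close>
    have sq: "(p + q + r)\<^sup>2 \<le> 3 * p\<^sup>2 + 3 * q\<^sup>2 + 3 * r\<^sup>2" for p q r :: real
      using zero_le_power2[of "p - q"] zero_le_power2[of "q - r"] zero_le_power2[of "p - r"]
      by (simp add: power2_eq_square algebra_simps)
    have "dist x y \<le> dist x x0 + dist x0 y0 + dist y y0"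
      by metric
    then have "(dist x y)\<^sup>2 \<le> (dist x x0 + dist x0 y0 + dist y y0)\<^sup>2"
      by (rule power_mono) simp
    also note sq
    finally have "ennreal ((dist x y)\<^sup>2) \<le>
        ennreal (3 * (dist x x0)\<^sup>2 + 3 * (dist x0 y0)\<^sup>2 + 3 * (dist y y0)\<^sup>2)"
      by (rule ennreal_leI)
    then show ?thesis
      by (simp add: ennreal_mult)
  qed
  have "(\<integral>\<^sup>+z. ennreal ((dist (fst z) (snd z))\<^sup>2) \<partial>(C \<Otimes>\<^sub>M C')) \<le>
      (\<integral>\<^sup>+x. \<integral>\<^sup>+y. (3 * ennreal ((dist x x0)\<^sup>2) + 3 * ennreal ((dist x0 y0)\<^sup>2)
        + 3 * ennreal ((dist y y0)\<^sup>2)) \<partial>C' \<partial>C)"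
    by (subst C'.nn_integral_fst[symmetric]) (auto intro!: nn_integral_mono split)
  also have "\<dots> = 3 * (\<integral>\<^sup>+x. ennreal ((dist x x0)\<^sup>2) \<partial>C) + 3 * ennreal ((dist x0 y0)\<^sup>2)
      + 3 * (\<integral>\<^sup>+y. ennreal ((dist y y0)\<^sup>2) \<partial>C')"
    by (simp add: nn_integral_add nn_integral_cmult C.emeasure_space_1 C'.emeasure_space_1)
  also have "\<dots> < \<infinity>"
    using fin by (simp add: ennreal_mult_less_top)
  finally show ?thesis
    using pair_measure_in_couplings[OF C] by (auto simp: INF_less_iff)
qed

section \<open>Bounds on the systematic-covariance ceiling\<close>

theorem mainTheorem4:
  fixes \<Gamma> :: "'h::{real_inner, polish_space} \<Rightarrow>\<^sub>L 'h"
    and t :: "'w::polish_space \<Rightarrow> 'h"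
    and T :: "'w \<times> 'u \<Rightarrow> 'h"
    and \<epsilon>\<^sub>i \<epsilon>\<^sub>j :: "'w \<times> 'u \<Rightarrow> 'h"
    and MU :: "'u measure"
    and L \<tau>\<^sub>i \<tau>\<^sub>j :: real
    and C\<^sub>i C\<^sub>j :: "'w measure"
    and M\<^sub>i :: "'a measure" and M\<^sub>j :: "'b measure"
    and X\<^sub>i :: "'a \<Rightarrow> 'w" and X\<^sub>j :: "'b \<Rightarrow> 'w"
    and U\<^sub>i :: "'a \<Rightarrow> 'u" and U\<^sub>j :: "'b \<Rightarrow> 'u"
    and B\<^sub>i :: "'a \<Rightarrow> 'h" and B\<^sub>j :: "'b \<Rightarrow> 'h"
    and P\<^sub>i P\<^sub>j :: "'h measure"
    and v\<^sub>i v\<^sub>j w_minus w_plus \<kappa> :: real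
  assumes \<Gamma>: "positive_op \<Gamma>"
    and t: "t \<in> borel_measurable borel"
    and t\<^sub>\<Gamma>: "borel_embedding (\<lambda>x. blinfun_apply (positive_sqrt \<Gamma>) (t x))"
    and L: "L \<ge> 1"
    and bilipschitz: "\<And>x y. dist x y / L \<le> norm (blinfun_apply (positive_sqrt \<Gamma>) (t x) - blinfun_apply (positive_sqrt \<Gamma>) (t y))
           \<and> norm (blinfun_apply (positive_sqrt \<Gamma>) (t x) - blinfun_apply (positive_sqrt \<Gamma>) (t y)) \<le> L * dist x y"
    and T: "T \<in> borel_measurable (borel \<Otimes>\<^sub>M MU)"
    and C: "C\<^sub>i \<in> P2" "C\<^sub>j \<in> P2"
    and M: "prob_space M\<^sub>i" "prob_space M\<^sub>j"
    and X\<^sub>i: "X\<^sub>i \<in> borel_measurable M\<^sub>i" "distr M\<^sub>i borel X\<^sub>i = C\<^sub>i"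
    and X\<^sub>j: "X\<^sub>j \<in> borel_measurable M\<^sub>j" "distr M\<^sub>j borel X\<^sub>j = C\<^sub>j"
    and U: "U\<^sub>i \<in> measurable M\<^sub>i MU" "U\<^sub>j \<in> measurable M\<^sub>j MU"
    and common_law: "distr M\<^sub>i MU U\<^sub>i = distr M\<^sub>j MU U\<^sub>j"
    and indep: "indep_elements M\<^sub>i borel X\<^sub>i MU U\<^sub>i" "indep_elements M\<^sub>j borel X\<^sub>j MU U\<^sub>j"
    and B\<^sub>i: "B\<^sub>i = (\<lambda>\<omega>. T (X\<^sub>i \<omega>, U\<^sub>i \<omega>))" "AE \<omega> in M\<^sub>i. B\<^sub>i \<omega> = t (X\<^sub>i \<omega>) + \<epsilon>\<^sub>i (X\<^sub>i \<omega>, U\<^sub>i \<omega>)"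
    and B\<^sub>j: "B\<^sub>j = (\<lambda>\<omega>. T (X\<^sub>j \<omega>, U\<^sub>j \<omega>))" "AE \<omega> in M\<^sub>j. B\<^sub>j \<omega> = t (X\<^sub>j \<omega>) + \<epsilon>\<^sub>j (X\<^sub>j \<omega>, U\<^sub>j \<omega>)"
    and \<epsilon>: "\<epsilon>\<^sub>i \<in> borel_measurable (borel \<Otimes>\<^sub>M MU)" "\<epsilon>\<^sub>j \<in> borel_measurable (borel \<Otimes>\<^sub>M MU)"
    and \<tau>: "\<tau>\<^sub>i \<ge> 0" "\<tau>\<^sub>j \<ge> 0"
    and \<epsilon>\<^sub>i_bound: "\<And>x u. u \<in> space MU \<Longrightarrow> norm (blinfun_apply (positive_sqrt \<Gamma>) (\<epsilon>\<^sub>i (x, u))) \<le> \<tau>\<^sub>i"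
    and \<epsilon>\<^sub>j_bound: "\<And>x u. u \<in> space MU \<Longrightarrow> norm (blinfun_apply (positive_sqrt \<Gamma>) (\<epsilon>\<^sub>j (x, u))) \<le> \<tau>\<^sub>j"
    and P: "P\<^sub>i = distr M\<^sub>i borel B\<^sub>i" "P\<^sub>j = distr M\<^sub>j borel B\<^sub>j"
    and P2: "P\<^sub>i \<in> P2" "P\<^sub>j \<in> P2"
    and w_minus: "w_minus = max (wasserstein2 dist C\<^sub>i C\<^sub>j / L - \<tau>\<^sub>i - \<tau>\<^sub>j) 0"
    and w_plus: "w_plus = L * wasserstein2 dist C\<^sub>i C\<^sub>j + \<tau>\<^sub>i + \<tau>\<^sub>j"
    and v\<^sub>i: "v\<^sub>i = (\<integral>\<omega>. (norm (blinfun_apply (positive_sqrt \<Gamma>) (B\<^sub>i \<omega>)))\<^sup>2 \<partial>M\<^sub>i)"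
    and v\<^sub>j: "v\<^sub>j = (\<integral>\<omega>. (norm (blinfun_apply (positive_sqrt \<Gamma>) (B\<^sub>j \<omega>)))\<^sup>2 \<partial>M\<^sub>j)"
    and \<kappa>: "\<kappa> = (v\<^sub>i + v\<^sub>j - wasserstein2_sq (weighted_dist \<Gamma>) P\<^sub>i P\<^sub>j) / 2"
  shows "(v\<^sub>i + v\<^sub>j - w_plus\<^sup>2) / 2 \<le> \<kappa> \<and> \<kappa> \<le> (v\<^sub>i + v\<^sub>j - w_minus\<^sup>2) / 2"
proof -
  let ?S = "blinfun_apply (positive_sqrt \<Gamma>)"
  let ?l = "norm (positive_sqrt \<Gamma>)"
  note [measurable] = t T X\<^sub>i(1) X\<^sub>j(1) U \<epsilon>
  have L0: "0 < L"
    using L by simp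
  \<comment> \<open>The decomposition of \<open>B\<^sub>i\<close> holds almost surely, while the
    transfer asks for a bound at every pair of points. \<open>Y\<^sub>i\<close> satisfies it
    everywhere and has the same law; likewise \<open>Y\<^sub>j\<close>.\<close>
  define Y\<^sub>i where "Y\<^sub>i \<omega> = t (X\<^sub>i \<omega>) + \<epsilon>\<^sub>i (X\<^sub>i \<omega>, U\<^sub>i \<omega>)" for \<omega>
  define Y\<^sub>j where "Y\<^sub>j \<omega> = t (X\<^sub>j \<omega>) + \<epsilon>\<^sub>j (X\<^sub>j \<omega>, U\<^sub>j \<omega>)" for \<omega>
  have Y_meas[measurable]: "Y\<^sub>i \<in> borel_measurable M\<^sub>i" "Y\<^sub>j \<in> borel_measurable M\<^sub>j"
    unfolding Y\<^sub>i_def Y\<^sub>j_def by measurable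
  have B_meas: "B\<^sub>i \<in> borel_measurable M\<^sub>i" "B\<^sub>j \<in> borel_measurable M\<^sub>j"
    unfolding B\<^sub>i(1) B\<^sub>j(1) by measurable
  have P_eq: "P\<^sub>i = distr M\<^sub>i borel Y\<^sub>i" "P\<^sub>j = distr M\<^sub>j borel Y\<^sub>j"
    unfolding P using B\<^sub>i(2) B\<^sub>j(2) B_meas Y_meas
    by (auto simp: Y\<^sub>i_def Y\<^sub>j_def intro!: distr_cong_AE)
  have S[measurable]: "?S \<in> borel_measurable borel"
    by (intro borel_measurable_continuous_onI continuous_intros)
  have wd[measurable]: "(\<lambda>z. weighted_dist \<Gamma> (fst z) (snd z)) \<in> borel_measurable (borel \<Otimes>\<^sub>M borel)"
    unfolding weighted_dist_def by measurable
  have dist_meas: "(\<lambda>z. dist (fst z) (snd z)) \<in> borel_measurable (borel \<Otimes>\<^sub>M borel :: ('w \<times> 'w) measure)"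
    by measurable
  have lip_dist: "dist x' y' \<le> dist x y + 1 * (dist x' x + dist y' y)" for x y x' y' :: 'w
    by metric
  \<comment> \<open>This supplies \<open>lip\<close> for the weighted distance: the operator norm of
    \<open>positive_sqrt \<Gamma>\<close> is a Lipschitz constant in each argument.\<close>
  have lip_weighted: "weighted_dist \<Gamma> x' y' \<le> weighted_dist \<Gamma> x y + ?l * (dist x' x + dist y' y)"
    for x y x' y'
  proof -
    have "norm (?S u - ?S v) \<le> ?l * dist u v" for u v
      using norm_blinfun[of "positive_sqrt \<Gamma>" "u - v"] by (simp add: blinfun.diff_right dist_norm)
    note this[of x' x] this[of y' y]
    moreover have "norm (?S x' - ?S y') \<le> norm (?S x - ?S y) + norm (?S x' - ?S x) + norm (?S y' - ?S y)"
      by norm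
    ultimately show ?thesis
      by (simp add: weighted_dist_def distrib_left)
  qed
  have err: "norm (?S (Y\<^sub>i \<omega>) - ?S (t (X\<^sub>i \<omega>))) \<le> \<tau>\<^sub>i" "norm (?S (Y\<^sub>j \<omega>') - ?S (t (X\<^sub>j \<omega>'))) \<le> \<tau>\<^sub>j"
    if "\<omega> \<in> space M\<^sub>i" "\<omega>' \<in> space M\<^sub>j" for \<omega> \<omega>'
    using \<epsilon>\<^sub>i_bound[OF measurable_space[OF U(1) that(1)]] \<epsilon>\<^sub>j_bound[OF measurable_space[OF U(2) that(2)]]
    by (simp_all add: Y\<^sub>i_def Y\<^sub>j_def blinfun.add_right)
  \<comment> \<open>The detour runs through the carrier values: the upper bi-Lipschitz bound
    controls the middle leg and \<open>err\<close> the two outer ones.\<close>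
  have upper: "weighted_dist \<Gamma> (Y\<^sub>i \<omega>) (Y\<^sub>j \<omega>') \<le> L * dist (X\<^sub>i \<omega>) (X\<^sub>j \<omega>') + (\<tau>\<^sub>i + \<tau>\<^sub>j)"
    if "\<omega> \<in> space M\<^sub>i" "\<omega>' \<in> space M\<^sub>j" for \<omega> \<omega>'
  proof -
    have "norm (?S (Y\<^sub>i \<omega>) - ?S (Y\<^sub>j \<omega>')) \<le> norm (?S (t (X\<^sub>i \<omega>)) - ?S (t (X\<^sub>j \<omega>')))
        + norm (?S (Y\<^sub>i \<omega>) - ?S (t (X\<^sub>i \<omega>))) + norm (?S (Y\<^sub>j \<omega>') - ?S (t (X\<^sub>j \<omega>')))"
      by norm
    with err[OF that] bilipschitz[of "X\<^sub>i \<omega>" "X\<^sub>j \<omega>'"] show ?thesis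
      by (simp add: weighted_dist_def)
  qed
  \<comment> \<open>The same detour in reverse, with the lower bi-Lipschitz bound. Clearing the
    division by \<open>L\<close> gives the affine form with slope \<open>L\<close> and constant
    \<open>L * (\<tau>\<^sub>i + \<tau>\<^sub>j)\<close>.\<close>
  have lower: "dist (X\<^sub>i \<omega>) (X\<^sub>j \<omega>') \<le> L * weighted_dist \<Gamma> (Y\<^sub>i \<omega>) (Y\<^sub>j \<omega>') + L * (\<tau>\<^sub>i + \<tau>\<^sub>j)"
    if "\<omega> \<in> space M\<^sub>i" "\<omega>' \<in> space M\<^sub>j" for \<omega> \<omega>'
  proof -
    have "norm (?S (t (X\<^sub>i \<omega>)) - ?S (t (X\<^sub>j \<omega>'))) \<le> norm (?S (Y\<^sub>i \<omega>) - ?S (Y\<^sub>j \<omega>'))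
        + norm (?S (Y\<^sub>i \<omega>) - ?S (t (X\<^sub>i \<omega>))) + norm (?S (Y\<^sub>j \<omega>') - ?S (t (X\<^sub>j \<omega>')))"
      by norm
    with err[OF that] bilipschitz[of "X\<^sub>i \<omega>" "X\<^sub>j \<omega>'"]
    have "dist (X\<^sub>i \<omega>) (X\<^sub>j \<omega>') / L \<le> weighted_dist \<Gamma> (Y\<^sub>i \<omega>) (Y\<^sub>j \<omega>') + (\<tau>\<^sub>i + \<tau>\<^sub>j)"
      by (simp add: weighted_dist_def)
    with L0 show ?thesis
      by (simp add: field_simps)
  qed
  have finC: "(INF \<gamma>\<in>couplings (distr M\<^sub>i borel X\<^sub>i) (distr M\<^sub>j borel X\<^sub>j).
      \<integral>\<^sup>+z. ennreal ((dist (fst z) (snd z))\<^sup>2) \<partial>\<gamma>) < \<infinity>"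
    using INF_couplings_dist_sq_finite[OF C] X\<^sub>i(2) X\<^sub>j(2) by simp
  let ?W = "wasserstein2 (weighted_dist \<Gamma>) P\<^sub>i P\<^sub>j" and ?V = "wasserstein2 dist C\<^sub>i C\<^sub>j"
  have wd0: "0 \<le> weighted_dist \<Gamma> x y" for x y
    by (simp add: weighted_dist_def)
  \<comment> \<open>First direction: from couplings of the characteristic laws to couplings of the
    exposure laws.\<close>
  note up = wasserstein2_affine_transfer[OF M X\<^sub>i(1) X\<^sub>j(1) Y_meas dist_meas wd zero_le_dist wd0
      lip_dist upper _ _ zero_le_one finC]
  have W_le: "?W \<le> w_plus"
    using up(2) L0 \<tau> by (simp add: w_plus P_eq X\<^sub>i(2) X\<^sub>j(2) add.assoc)
  \<comment> \<open>The first transfer also yields the finiteness that the reverse transfer takes as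
    a hypothesis.\<close>
  have finP: "(INF \<gamma>\<in>couplings (distr M\<^sub>i borel Y\<^sub>i) (distr M\<^sub>j borel Y\<^sub>j).
      \<integral>\<^sup>+z. ennreal ((weighted_dist \<Gamma> (fst z) (snd z))\<^sup>2) \<partial>\<gamma>) < \<infinity>"
    using up(1) L0 \<tau> by simp
  have "?V \<le> L * ?W + L * (\<tau>\<^sub>i + \<tau>\<^sub>j)"
    using wasserstein2_affine_transfer(2)[OF M Y_meas X\<^sub>i(1) X\<^sub>j(1) wd dist_meas wd0 zero_le_dist
        lip_weighted lower _ _ norm_ge_zero finP] L0 \<tau>
    by (simp add: P_eq X\<^sub>i(2) X\<^sub>j(2))
  then have "?V / L - \<tau>\<^sub>i - \<tau>\<^sub>j \<le> ?W"
    using L0 by (simp add: field_simps)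
  moreover have W0: "0 \<le> ?W" and sq: "wasserstein2_sq (weighted_dist \<Gamma>) P\<^sub>i P\<^sub>j = ?W\<^sup>2"
    by (simp_all add: wasserstein2_def wasserstein2_sq_def)
  \<comment> \<open>Since \<open>?W\<close> is nonnegative, the positive part stays below it, and
    squaring preserves the order.\<close>
  ultimately have "w_minus\<^sup>2 \<le> ?W\<^sup>2"
    unfolding w_minus by (intro power_mono) auto
  moreover have "?W\<^sup>2 \<le> w_plus\<^sup>2"
    using W_le W0 by (rule power_mono)
  \<comment> \<open>\<open>\<kappa>\<close> decreases in the squared distance, so
    \<open>w_plus\<close> gives its lower bound and \<open>w_minus\<close> its upper bound.\<close>
  ultimately show ?thesis
    by (simp add: \<kappa> sq)
qed

end
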